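(* Let $n\geq 3$. If combinatorially equivalent zonotopes $\mathcal{Z}$ and $\mathcal{Z}'$ in $\mathbb{R}^n$ have congruent corresponding facets, then $\mathcal{Z}$ and $\mathcal{Z}'$ are congruent.
   Context: A zonotope in $\mathbb{R}^n$ is a set of the form $\mathcal{Z}(A)=\{\sum_{i=1}^k t_i\boldsymbol{a}_i\mid 0\leq t_i\leq 1\}$ where $A=[\boldsymbol{a}_1,\ldots,\boldsymbol{a}_k]$ is a real $n\times k$ matrix with columns $\boldsymbol{a}_1,\ldots,\boldsymbol{a}_k$; it is a convex polytope. A facet of a polytope is a face of dimension one less than the dimension of the polytope. Two polytopes are combinatorially equivalent if they have the same face lattice structure, that is, if there is an isomorphism between their face lattices; facets matched by this isomorphism are called corresponding. Two sets are congruent if some isometry of the ambient Euclidean space carries one onto the other; having congruent corresponding facets means that each facet of $\mathcal{Z}$ is congruent to the corresponding facet of $\mathcal{Z}'$.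
   Formalization: "Congruent corresponding facets" is taken to mean that some isometry carries each facet and each of its faces onto the corresponding ones (else acute and obtuse rhombohedra are a counterexample), and Z is assumed to have dimension at least 3 (a square and a rhombus in R^3 refute it otherwise). *)

theory Defs
  imports "HOL-Analysis.Analysis"
begin

definition zonotope :: "real^'k^'n \<Rightarrow> (real^'n) set" where
  "zonotope A = {\<Sum>i\<in>UNIV. t i *\<^sub>R column i A | t. \<forall>i. 0 \<le> t i \<and> t i \<le> 1}"

(* The face lattice of P is {F. F face_of P} ordered by inclusion; face_of admits the
   improper faces {} and P. A bijection that preserves and reflects the order is an
   isomorphism of lattices. *)
definition face_lattice_iso ::
    "('a::euclidean_space set \<Rightarrow> 'b::euclidean_space set) \<Rightarrow> 'a set \<Rightarrow> 'b set \<Rightarrow> bool" where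
  "face_lattice_iso \<phi> P Q \<longleftrightarrow>
     bij_betw \<phi> {F. F face_of P} {G. G face_of Q} \<and>
     (\<forall>F G. F face_of P \<longrightarrow> G face_of P \<longrightarrow> (F \<subseteq> G \<longleftrightarrow> \<phi> F \<subseteq> \<phi> G))"

definition euclidean_isometry :: "('a::euclidean_space \<Rightarrow> 'a) \<Rightarrow> bool" where
  "euclidean_isometry f \<longleftrightarrow> (\<forall>x y. dist (f x) (f y) = dist x y)"

definition congruent_sets :: "'a::euclidean_space set \<Rightarrow> 'a set \<Rightarrow> bool" where
  "congruent_sets S T \<longleftrightarrow> (\<exists>f. euclidean_isometry f \<and> f ` S = T)"

(* "Congruent corresponding facets" is meant as in Cauchy's rigidity theorem: the congruence
   between F and \<phi> F realises the given combinatorial equivalence, that is, it carries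
   each face of F onto the corresponding face of \<phi> F. Asking only that F and \<phi> F be
   congruent as sets is not enough: the acute and the obtuse rhombohedron with the same
   rhombus as facets are combinatorially equivalent and all their facets are congruent, but
   they have different volumes. *)
definition congruent_corresponding_facets ::
    "('a::euclidean_space set \<Rightarrow> 'a set) \<Rightarrow> 'a set \<Rightarrow> bool" where
  "congruent_corresponding_facets \<phi> P \<longleftrightarrow>
     (\<forall>F. F facet_of P \<longrightarrow>
        (\<exists>f. euclidean_isometry f \<and> f ` F = \<phi> F \<and> (\<forall>G. G face_of F \<longrightarrow> f ` G = \<phi> G)))"

end

theory Submission
  imports Defs
begin

text \<open>
Let \<open>Z\<close> be a zonotope with generators \<open>a i\<close>, and let \<open>V\<close> be their span, of dimension at least 3.
For a direction \<open>w \<in> V\<close>, let \<open>F w\<close> be the face of \<open>Z\<close> on which \<open>w\<close> is maximal; it is a translate of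
the zonotope generated by the \<open>a i\<close> orthogonal to \<open>w\<close>.  If \<open>w \<noteq> 0\<close> then \<open>F w\<close> is a proper face and lies
in a facet, whose congruence supplies an isometry \<open>f w = L w + const\<close> that agrees with the
given correspondence on the vertices of \<open>F w\<close>.

The isometries of the facets fit together because everything about them is locally constant in \<open>w\<close>
on a connected set.  For \<open>w'\<close> close to \<open>w\<close> one has \<open>F w' \<subseteq> F w\<close>
(\<open>eventually_zono_face_subset\<close>), and there \<open>f w'\<close> and \<open>f w\<close> agree, as they agree on vertices.
The gluing (\<open>face_isometries_glue\<close>) has three steps.

\<^item> The directions \<open>w \<noteq> 0\<close> of \<open>V\<close> orthogonal to \<open>a i\<close> form a punctured subspace of dimension at least 2,
  hence a connected set, and \<open>L w (a i)\<close> is locally constant on it, because \<open>F w'\<close> contains a translate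
  of the segment from \<open>0\<close> to \<open>a i\<close>.  So \<open>L w (a i)\<close> is a vector \<open>b i\<close> that does not depend on \<open>w\<close>.
\<^item> As \<open>dim V \<ge> 3\<close>, any two generators \<open>a i\<close>, \<open>a j\<close> have a common orthogonal direction \<open>w \<noteq> 0\<close> in \<open>V\<close>, and
  the orthogonal map \<open>L w\<close> sends them to \<open>b i\<close>, \<open>b j\<close>.  So the two families have the same Gram matrix,
  and one orthogonal map \<open>T\<close> sends every \<open>a i\<close> to \<open>b i\<close>
  (\<open>orthogonal_transformation_of_inner_eq\<close>).
\<^item> On \<open>F w\<close> the difference \<open>f w - T\<close> is a constant \<open>c w\<close>, and \<open>c\<close> is locally constant on the
  connected set \<open>V - {0}\<close>.  So one isometry \<open>x \<mapsto> T x + d\<close> agrees with each \<open>f w\<close> on \<open>F w\<close>.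

This isometry maps the vertices of \<open>Z\<close> as the isomorphism of the face lattices does, hence onto the
vertices of the other zonotope, and a polytope is the convex hull of its vertices.
\<close>

section \<open>Isometries\<close>

lemma euclidean_isometryE:
  assumes "euclidean_isometry f"
  obtains L where "orthogonal_transformation L" "\<And>x. f x = L x + f 0"
proof
  have "dist (f x - f 0) (f y - f 0) = dist (f x) (f y)" for x y
    by (simp add: dist_norm)
  then show "orthogonal_transformation (\<lambda>x. f x - f 0)"
    using assms by (simp add: orthogonal_transformation_isometry euclidean_isometry_def)
qed auto

lemma euclidean_isometry_orthogonal_translation:
  "orthogonal_transformation L \<Longrightarrow> euclidean_isometry (\<lambda>x. L x + c)"
  by (simp add: euclidean_isometry_def orthogonal_transformation_isometry)

lemma orthogonal_transformation_reflection:
  fixes d :: "'a::euclidean_space"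
  shows "orthogonal_transformation (\<lambda>x. x - (2 * (d \<bullet> x) / (d \<bullet> d)) *\<^sub>R d)"
  unfolding orthogonal_transformation_def
proof (intro conjI allI)
  define k where "k = 2 / (d \<bullet> d)"
  have coeff: "2 * (d \<bullet> x) / (d \<bullet> d) = k * (d \<bullet> x)" for x
    by (simp add: k_def)
  show "linear (\<lambda>x. x - (2 * (d \<bullet> x) / (d \<bullet> d)) *\<^sub>R d)"
    unfolding coeff by (rule linearI) (simp_all add: inner_add_right algebra_simps)
  fix x y
  show "(x - (2 * (d \<bullet> x) / (d \<bullet> d)) *\<^sub>R d) \<bullet> (y - (2 * (d \<bullet> y) / (d \<bullet> d)) *\<^sub>R d) = x \<bullet> y"
  proof (cases "d = 0")
    case False
    then have k: "k * (d \<bullet> d) = 2" by (simp add: k_def)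
    have "(x - (k * (d \<bullet> x)) *\<^sub>R d) \<bullet> (y - (k * (d \<bullet> y)) *\<^sub>R d)
        = x \<bullet> y - 2 * k * (d \<bullet> x) * (d \<bullet> y) + k * (d \<bullet> x) * (d \<bullet> y) * (k * (d \<bullet> d))"
      by (simp add: inner_diff_left inner_diff_right inner_commute algebra_simps)
    then show ?thesis
      unfolding coeff k by simp
  qed simp
qed

text \<open>
Induction over the vectors.  If \<open>T\<close> is right for the old ones, let \<open>d\<close> be the error at the new
vector.  Equality of the inner products makes \<open>d\<close> orthogonal to all old images and makes the two
vectors to be matched equally long, so the reflection along \<open>d\<close> corrects the error and keeps what
was achieved.
\<close>

lemma orthogonal_transformation_of_inner_eq:
  fixes a b :: "'i \<Rightarrow> 'a::euclidean_space"
  assumes "finite I" and "\<And>i j. i \<in> I \<Longrightarrow> j \<in> I \<Longrightarrow> b i \<bullet> b j = a i \<bullet> a j"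
  shows "\<exists>T. orthogonal_transformation T \<and> (\<forall>i\<in>I. T (a i) = b i)"
  using assms
proof (induction I rule: finite_induct)
  case empty
  then show ?case using orthogonal_transformation_id by blast
next
  case (insert k I)
  then obtain T where T: "orthogonal_transformation T" "\<And>i. i \<in> I \<Longrightarrow> T (a i) = b i"
    by auto
  define d where "d = T (a k) - b k"
  define R where "R x = x - (2 * (d \<bullet> x) / (d \<bullet> d)) *\<^sub>R d" for x
  have R: "orthogonal_transformation R"
    using orthogonal_transformation_reflection[of d] by (simp add: R_def[abs_def])
  have T_inner: "T x \<bullet> T y = x \<bullet> y" for x y
    using T(1) by (simp add: orthogonal_transformation_def)
  have "d \<bullet> b i = 0" if "i \<in> I" for i
    using T_inner[of "a k" "a i"] T(2)[OF that] insert.prems[of k i] that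
    by (simp add: d_def inner_diff_left)
  then have fixes_old: "R (b i) = b i" if "i \<in> I" for i
    using that by (simp add: R_def)
  have "2 * (d \<bullet> T (a k)) = d \<bullet> d"
    using T_inner[of "a k" "a k"] insert.prems[of k k]
    by (simp add: d_def inner_diff_left inner_diff_right inner_commute)
  then have "R (T (a k)) = b k"
    by (cases "d = 0") (auto simp: R_def d_def)
  then have "\<forall>i\<in>insert k I. (R \<circ> T) (a i) = b i"
    using T(2) fixes_old by auto
  then show ?case
    using orthogonal_transformation_compose[OF R T(1)] by blast
qed

section \<open>Exposed faces of a zonotope\<close>

text \<open>
The set of points of the zonotope with generators \<open>a i\<close> at which \<open>w\<close> is maximal, given by
coefficients so that the dependence on \<open>w\<close> is only through the signs of \<open>w \<bullet> a i\<close>.  The direction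
\<open>w = 0\<close> gives the whole zonotope.
\<close>

definition zono_face :: "('i::finite \<Rightarrow> 'a::euclidean_space) \<Rightarrow> 'a \<Rightarrow> 'a set" where
  "zono_face a w = {\<Sum>i\<in>UNIV. t i *\<^sub>R a i | t.
     \<forall>i. 0 \<le> t i \<and> t i \<le> 1 \<and> (0 < w \<bullet> a i \<longrightarrow> t i = 1) \<and> (w \<bullet> a i < 0 \<longrightarrow> t i = 0)}"

lemma zonotope_eq_zono_face: "zonotope A = zono_face (\<lambda>i. column i A) 0"
  by (simp add: zonotope_def zono_face_def)

lemma zono_face_subset_span: "zono_face a w \<subseteq> span (range a)"
  unfolding zono_face_def by clarify (intro span_sum span_scale span_base rangeI)

lemma polytope_zono_face_0:
  fixes a :: "'i::finite \<Rightarrow> 'a::euclidean_space"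
  shows "polytope (zono_face a 0)"
proof -
  let ?h = "\<lambda>t::real^'i. \<Sum>i\<in>UNIV. (t $ i) *\<^sub>R a i"
  have "linear ?h"
    by (auto intro!: linearI simp: scaleR_left_distrib sum.distrib scaleR_sum_right)
  then have "polytope (?h ` cbox 0 1)"
    using polytope_interval by (rule polytope_linear_image)
  moreover have "zono_face a 0 = ?h ` cbox 0 1"
  proof (intro equalityI subsetI)
    fix x assume "x \<in> zono_face a 0"
    then obtain t where t: "\<forall>i. 0 \<le> t i \<and> t i \<le> 1" "x = (\<Sum>i\<in>UNIV. t i *\<^sub>R a i)"
      by (auto simp: zono_face_def)
    then have "(\<chi> i. t i) \<in> cbox 0 1" "x = ?h (\<chi> i. t i)"
      by (auto simp: mem_box_cart)
    then show "x \<in> ?h ` cbox 0 1" by blast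
  qed (auto simp: zono_face_def mem_box_cart)
  ultimately show ?thesis
    by simp
qed

text \<open>
The number \<open>h a w\<close> is the support function of the zonotope.  For \<open>x\<close> with coefficients \<open>t\<close>, the
gap \<open>h a w - w \<bullet> x\<close> is a sum of nonnegative terms, one for each generator, and the term of \<open>a i\<close>
vanishes exactly when \<open>t i\<close> is as the sign of \<open>w \<bullet> a i\<close> prescribes.
\<close>

lemma zono_face_eq_maximizers:
  defines "h \<equiv> \<lambda>a w. \<Sum>i\<in>UNIV. max 0 (w \<bullet> a i)"
  shows "x \<in> zono_face a 0 \<Longrightarrow> w \<bullet> x \<le> h a w"
    and "zono_face a w = zono_face a 0 \<inter> {x. w \<bullet> x = h a w}"
proof -
  have gap: "h a w - w \<bullet> (\<Sum>i\<in>UNIV. t i *\<^sub>R a i)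
      = (\<Sum>i\<in>UNIV. max 0 (w \<bullet> a i) - t i * (w \<bullet> a i))" for t
    by (simp add: h_def inner_sum_right sum_subtractf)
  have nonneg: "0 \<le> max 0 (w \<bullet> a i) - t i * (w \<bullet> a i)" if "0 \<le> t i" "t i \<le> 1" for t i
    using that mult_left_le_one_le[of "w \<bullet> a i" "t i"] mult_nonneg_nonpos[of "t i" "w \<bullet> a i"]
    by (cases "0 \<le> w \<bullet> a i") auto
  show "w \<bullet> x \<le> h a w" if x: "x \<in> zono_face a 0"
  proof -
    obtain t where t: "\<forall>i. 0 \<le> t i \<and> t i \<le> 1" "x = (\<Sum>i\<in>UNIV. t i *\<^sub>R a i)"
      using x by (auto simp: zono_face_def)
    have "0 \<le> h a w - w \<bullet> x"
      unfolding t(2) gap by (intro sum_nonneg nonneg) (use t in auto)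
    then show ?thesis by simp
  qed
  have iff: "w \<bullet> (\<Sum>i\<in>UNIV. t i *\<^sub>R a i) = h a w
      \<longleftrightarrow> (\<forall>i. (0 < w \<bullet> a i \<longrightarrow> t i = 1) \<and> (w \<bullet> a i < 0 \<longrightarrow> t i = 0))"
    if t: "\<forall>i. 0 \<le> t i \<and> t i \<le> 1" for t
  proof -
    have "w \<bullet> (\<Sum>i\<in>UNIV. t i *\<^sub>R a i) = h a w
        \<longleftrightarrow> (\<Sum>i\<in>UNIV. max 0 (w \<bullet> a i) - t i * (w \<bullet> a i)) = 0"
      using gap[of t] by auto
    also have "\<dots> \<longleftrightarrow> (\<forall>i. max 0 (w \<bullet> a i) - t i * (w \<bullet> a i) = 0)"
      using t by (subst sum_nonneg_eq_0_iff) (simp_all add: nonneg del: diff_ge_0_iff_ge)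
    also have "\<dots> \<longleftrightarrow> (\<forall>i. (0 < w \<bullet> a i \<longrightarrow> t i = 1) \<and> (w \<bullet> a i < 0 \<longrightarrow> t i = 0))"
      by (intro arg_cong[where f = All] ext) (auto simp: max_def)
    finally show ?thesis .
  qed
  show "zono_face a w = zono_face a 0 \<inter> {x. w \<bullet> x = h a w}"
  proof (intro equalityI subsetI)
    fix x assume "x \<in> zono_face a w"
    then obtain t where "x = (\<Sum>i\<in>UNIV. t i *\<^sub>R a i)" "\<forall>i. 0 \<le> t i \<and> t i \<le> 1"
      "\<forall>i. (0 < w \<bullet> a i \<longrightarrow> t i = 1) \<and> (w \<bullet> a i < 0 \<longrightarrow> t i = 0)"
      by (auto simp: zono_face_def)
    then show "x \<in> zono_face a 0 \<inter> {x. w \<bullet> x = h a w}"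
      using iff[of t] by (auto simp: zono_face_def)
  next
    fix x assume x: "x \<in> zono_face a 0 \<inter> {x. w \<bullet> x = h a w}"
    then obtain t where "x = (\<Sum>i\<in>UNIV. t i *\<^sub>R a i)" "\<forall>i. 0 \<le> t i \<and> t i \<le> 1"
      by (auto simp: zono_face_def)
    then show "x \<in> zono_face a w"
      using iff[of t] x unfolding zono_face_def by blast
  qed
qed

lemma zono_face_face_of: "zono_face a w face_of zono_face a 0"
  unfolding zono_face_eq_maximizers(2)[of a w]
  using polytope_zono_face_0 zono_face_eq_maximizers(1)
  by (intro face_of_Int_supporting_hyperplane_le polytope_imp_convex) auto

text \<open>
Used as an equivalence, the next two facts would rewrite indefinitely, since the whole zonotope is
itself a \<open>zono_face\<close>.
\<close>

lemma extreme_point_of_zono_faceD: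
  "x extreme_point_of zono_face a w \<Longrightarrow> x extreme_point_of zono_face a 0"
  using extreme_point_of_face[OF zono_face_face_of] by blast

lemma extreme_point_of_zono_faceI:
  "x extreme_point_of zono_face a 0 \<Longrightarrow> x \<in> zono_face a w \<Longrightarrow> x extreme_point_of zono_face a w"
  using extreme_point_of_face[OF zono_face_face_of] by blast

lemma zono_face_convex_hull_extreme_points:
  "zono_face a w = convex hull {x. x extreme_point_of zono_face a w}"
proof (rule Krein_Milman_Minkowski)
  show "compact (zono_face a w)"
    using polytope_zono_face_0 zono_face_face_of
    by (blast intro: face_of_imp_compact polytope_imp_compact polytope_imp_convex)
  show "convex (zono_face a w)"
    using zono_face_face_of by (rule face_of_imp_convex)
qed

lemma zono_face_contains_orthogonal_generator:
  assumes "w \<bullet> a i = 0"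
  obtains x where "x \<in> zono_face a w" "x + a i \<in> zono_face a w"
proof
  define t where "t j = (if 0 < w \<bullet> a j then 1 else 0 :: real)" for j
  show "(\<Sum>j\<in>UNIV. t j *\<^sub>R a j) \<in> zono_face a w"
    unfolding zono_face_def by (auto simp: t_def)
  have "(\<Sum>j\<in>UNIV. t j *\<^sub>R a j) + a i
      = (\<Sum>j\<in>UNIV. t j *\<^sub>R a j + (if j = i then a j else 0))"
    by (simp add: sum.distrib)
  also have "\<dots> = (\<Sum>j\<in>UNIV. (if j = i then 1 else t j) *\<^sub>R a j)"
    by (rule sum.cong) (auto simp: t_def assms)
  also have "\<dots> \<in> zono_face a w"
    unfolding zono_face_def using assms
    by (intro CollectI exI[of _ "\<lambda>j. if j = i then 1 else t j"]) (auto simp: t_def)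
  finally show "(\<Sum>j\<in>UNIV. t j *\<^sub>R a j) + a i \<in> zono_face a w" .
qed

lemma zono_face_nonempty: "zono_face a w \<noteq> {}"
proof -
  have "(\<Sum>j\<in>UNIV. (if 0 < w \<bullet> a j then 1 else 0) *\<^sub>R a j) \<in> zono_face a w"
    unfolding zono_face_def
    by (intro CollectI exI[of _ "\<lambda>j. if 0 < w \<bullet> a j then 1 else 0"]) auto
  then show ?thesis by blast
qed

lemma zono_face_diff_in_span:
  assumes "x \<in> zono_face a w" "y \<in> zono_face a w"
  shows "x - y \<in> span {a i |i. w \<bullet> a i = 0}"
proof -
  obtain t s where
    t: "x = (\<Sum>i\<in>UNIV. t i *\<^sub>R a i)"
      "\<And>i. (0 < w \<bullet> a i \<longrightarrow> t i = 1) \<and> (w \<bullet> a i < 0 \<longrightarrow> t i = 0)" and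
    s: "y = (\<Sum>i\<in>UNIV. s i *\<^sub>R a i)"
      "\<And>i. (0 < w \<bullet> a i \<longrightarrow> s i = 1) \<and> (w \<bullet> a i < 0 \<longrightarrow> s i = 0)"
    using assms unfolding zono_face_def by blast
  have "x - y = (\<Sum>i\<in>UNIV. (t i - s i) *\<^sub>R a i)"
    by (simp add: t s scaleR_left_diff_distrib sum_subtractf)
  also have "\<dots> \<in> span {a i |i. w \<bullet> a i = 0}"
  proof (rule span_sum)
    fix i
    show "(t i - s i) *\<^sub>R a i \<in> span {a i |i. w \<bullet> a i = 0}"
    proof (cases "w \<bullet> a i = 0")
      case True
      then show ?thesis by (intro span_scale span_base) blast
    next
      case False
      then have "t i = s i" using t(2)[of i] s(2)[of i] by linarith
      then show ?thesis by (simp add: span_zero)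
    qed
  qed
  finally show ?thesis .
qed

text \<open>
A small change of \<open>w\<close> keeps the strict signs of the finitely many numbers \<open>w \<bullet> a i\<close>, so it can only
add constraints on the coefficients.
\<close>

lemma eventually_zono_face_subset:
  "eventually (\<lambda>w'. zono_face a w' \<subseteq> zono_face a w) (nhds w)"
proof -
  have lim: "((\<lambda>w'. w' \<bullet> a i) \<longlongrightarrow> w \<bullet> a i) (nhds w)" for i
    by (intro tendsto_intros filterlim_ident)
  have "eventually (\<lambda>w'. (0 < w \<bullet> a i \<longrightarrow> 0 < w' \<bullet> a i) \<and>
      (w \<bullet> a i < 0 \<longrightarrow> w' \<bullet> a i < 0)) (nhds w)" for i
    using order_tendstoD[OF lim[of i], of 0]
    by (cases "w \<bullet> a i" "0::real" rule: linorder_cases) (auto elim: eventually_mono)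
  then have "eventually (\<lambda>w'. \<forall>i. (0 < w \<bullet> a i \<longrightarrow> 0 < w' \<bullet> a i) \<and>
      (w \<bullet> a i < 0 \<longrightarrow> w' \<bullet> a i < 0)) (nhds w)"
    by (rule eventually_all_finite)
  then show ?thesis
    by (rule eventually_mono) (unfold zono_face_def, blast)
qed

text \<open>
If \<open>w\<close> were maximal on the whole zonotope, it would be constant along each generator, hence
orthogonal to all of them, and so to itself.
\<close>

lemma zono_face_proper:
  assumes "w \<in> span (range a)" "w \<noteq> 0"
  shows "zono_face a w \<noteq> zono_face a 0"
proof
  assume eq: "zono_face a w = zono_face a 0"
  have "w \<bullet> a i = 0" for i
  proof -
    obtain x where "x \<in> zono_face a 0" "x + a i \<in> zono_face a 0"
      by (rule zono_face_contains_orthogonal_generator[of 0 a i]) auto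
    then have "x \<in> zono_face a w" "x + a i \<in> zono_face a w"
      using eq by auto
    then have "w \<bullet> x = w \<bullet> (x + a i)"
      unfolding zono_face_eq_maximizers(2)[of a w] by auto
    then show ?thesis by (simp add: inner_add_right)
  qed
  then have "w \<in> span (range a) \<Longrightarrow> orthogonal w w"
    by (intro orthogonal_to_span[of w "range a"]) (auto simp: orthogonal_def)
  then show False using assms by (simp add: orthogonal_def)
qed

text \<open>
A supporting hyperplane at a relative boundary point gives a direction; its projection to the span
of the generators has the same values on the zonotope, and it is nonzero because the hyperplane
does not contain the relative interior.
\<close>

lemma extreme_point_in_proper_zono_face:
  assumes x: "x extreme_point_of zono_face a 0" and a: "\<exists>i. a i \<noteq> 0"
  obtains w where "w \<in> span (range a)" "w \<noteq> 0" "x \<in> zono_face a w"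
proof -
  let ?Z = "zono_face a 0"
  have conv: "convex ?Z" by (simp add: polytope_zono_face_0 polytope_imp_convex)
  have xZ: "x \<in> ?Z" using x by (simp add: extreme_point_of_def)
  have "?Z \<noteq> {x}"
  proof
    assume "?Z = {x}"
    moreover obtain i where "a i \<noteq> 0" using a by blast
    moreover obtain y where "y \<in> ?Z" "y + a i \<in> ?Z"
      by (rule zono_face_contains_orthogonal_generator[of 0 a i]) auto
    ultimately show False by auto
  qed
  then have "x \<notin> rel_interior ?Z"
    using x extreme_point_not_in_REL_INTERIOR by blast
  then obtain u where u: "\<And>y. y \<in> ?Z \<Longrightarrow> u \<bullet> x \<le> u \<bullet> y"
    "\<And>y. y \<in> rel_interior ?Z \<Longrightarrow> u \<bullet> x < u \<bullet> y"
    using supporting_hyperplane_rel_boundary[OF conv xZ] rel_interior_subset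
      hull_subset closure_subset by (metis subsetD)
  obtain v v' where v: "v \<in> span (range a)" "\<And>z. z \<in> span (range a) \<Longrightarrow> orthogonal v' z" "u = v + v'"
    using orthogonal_subspace_decomp_exists by metis
  have uv: "u \<bullet> y = v \<bullet> y" if "y \<in> ?Z" for y
    using v(2)[of y] that zono_face_subset_span[of a 0]
    by (auto simp: v(3) inner_add_left orthogonal_def)
  show ?thesis
  proof
    show "- v \<in> span (range a)" using v(1) by (rule span_neg)
    obtain y where "y \<in> rel_interior ?Z"
      using rel_interior_eq_empty[OF conv] zono_face_nonempty[of a 0] by blast
    then have "v \<bullet> x < v \<bullet> y"
      using u(2) uv xZ rel_interior_subset by (metis subsetD)
    then show "- v \<noteq> 0" by auto
    obtain z where "z \<in> zono_face a (- v)" using zono_face_nonempty by blast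
    then have z: "z \<in> ?Z" "(- v) \<bullet> z = (\<Sum>i\<in>UNIV. max 0 ((- v) \<bullet> a i))"
      unfolding zono_face_eq_maximizers(2)[of a "- v"] by auto
    have "(- v) \<bullet> z \<le> (- v) \<bullet> x"
      using u(1)[OF z(1)] uv[OF z(1)] uv[OF xZ] by simp
    moreover have "(- v) \<bullet> x \<le> (\<Sum>i\<in>UNIV. max 0 ((- v) \<bullet> a i))"
      using xZ by (rule zono_face_eq_maximizers(1))
    ultimately have "(- v) \<bullet> x = (\<Sum>i\<in>UNIV. max 0 ((- v) \<bullet> a i))"
      using z(2) by linarith
    then show "x \<in> zono_face a (- v)"
      unfolding zono_face_eq_maximizers(2)[of a "- v"] using xZ by auto
  qed
qed

section \<open>Gluing the isometries of the faces\<close>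

lemma dim_orthogonal_complement_in_subspace_ge:
  fixes V :: "'a::euclidean_space set"
  assumes "subspace V" "finite X" "X \<subseteq> V"
  shows "dim V \<le> dim {w \<in> V. \<forall>x\<in>X. w \<bullet> x = 0} + card X"
proof -
  have "{y \<in> V. \<forall>x\<in>span X. orthogonal x y} = {w \<in> V. \<forall>x\<in>X. w \<bullet> x = 0}"
  proof -
    have "(\<forall>x\<in>span X. orthogonal x y) \<longleftrightarrow> (\<forall>x\<in>X. y \<bullet> x = 0)" for y
      by (metis orthogonal_to_span orthogonal_commute orthogonal_def span_base)
    then show ?thesis by simp
  qed
  moreover have "dim {y \<in> V. \<forall>x\<in>span X. orthogonal x y} + dim (span X) = dim V"
    using assms by (intro dim_subspace_orthogonal_to_vectors span_minimal) auto
  moreover have "dim (span X) \<le> card X"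
    using assms(2) by (simp add: dim_le_card')
  ultimately show ?thesis by simp
qed

lemma subspace_orthogonal_in_subspace:
  "subspace V \<Longrightarrow> subspace {w \<in> V. \<forall>x\<in>X. w \<bullet> x = (0::real)}"
  by (auto simp: subspace_def inner_add_left)

lemma connected_punctured_subspace:
  fixes V :: "'a::euclidean_space set"
  assumes "subspace V" "2 \<le> dim V"
  shows "connected (V - {0})"
  using assms by (intro connected_punctured_convex subspace_imp_convex) (simp_all add: aff_dim_subspace)

lemma isometries_eq_on_convex_hull:
  assumes "euclidean_isometry f" "euclidean_isometry g"
    and "\<And>x. x \<in> X \<Longrightarrow> f x = g x" and "x \<in> convex hull X"
  shows "f x = g x"
proof -
  obtain L where L: "orthogonal_transformation L" "\<And>x. f x = L x + f 0"
    using assms(1) euclidean_isometryE by blast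
  obtain M where M: "orthogonal_transformation M" "\<And>x. g x = M x + g 0"
    using assms(2) euclidean_isometryE by blast
  have affine: "h (u *\<^sub>R x + v *\<^sub>R y) = u *\<^sub>R h x + v *\<^sub>R h y"
    if "orthogonal_transformation N" "\<And>x. h x = N x + h 0" "u + v = 1" for h N and u v :: real and x y
  proof -
    have "linear N" using that(1) by (rule orthogonal_transformation_linear)
    then have "h (u *\<^sub>R x + v *\<^sub>R y) = u *\<^sub>R N x + v *\<^sub>R N y + (u + v) *\<^sub>R h 0"
      using that(2)[of "u *\<^sub>R x + v *\<^sub>R y"] that(3) by (simp add: linear_add linear_scale)
    also have "\<dots> = u *\<^sub>R (N x + h 0) + v *\<^sub>R (N y + h 0)"
      by (simp add: algebra_simps)
    finally show ?thesis using that(2) by metis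
  qed
  have "convex {x. f x = g x}"
    unfolding convex_def using affine[OF L] affine[OF M] by auto
  then have "convex hull X \<subseteq> {x. f x = g x}"
    using assms(3) by (intro hull_minimal) auto
  then show ?thesis using assms(4) by blast
qed

lemma exists_nonzero_if_dim_range_pos:
  fixes a :: "'i \<Rightarrow> 'a::euclidean_space"
  assumes "0 < dim (range a)"
  shows "\<exists>i. a i \<noteq> 0"
proof (rule ccontr)
  assume "\<not> ?thesis"
  then have "range a \<subseteq> {0}" by auto
  then show False using assms dim_eq_0 by (metis less_irrefl)
qed

text \<open>
Isometries chosen for two faces agree where one face contains the other, and nearby directions have
nested faces.  So both the image of a generator and the translation part are locally constant in
\<open>w\<close>; connectedness of the sets of directions makes them constant.
\<close>

lemma face_isometries_glue:
  fixes a :: "'i::finite \<Rightarrow> 'a::euclidean_space" and p :: "'a \<Rightarrow> 'a"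
  assumes dim3: "3 \<le> dim (range a)"
    and faces: "\<And>w. w \<in> span (range a) \<Longrightarrow> w \<noteq> 0 \<Longrightarrow>
      \<exists>f. euclidean_isometry f \<and> (\<forall>x. x extreme_point_of zono_face a w \<longrightarrow> f x = p x)"
  obtains g where "euclidean_isometry g"
    "\<And>x. x extreme_point_of zono_face a 0 \<Longrightarrow> g x = p x"
proof -
  define V where "V = span (range a)"
  have V: "subspace V" "3 \<le> dim V" "\<And>i. a i \<in> V"
    using dim3 by (auto simp: V_def intro: span_base)
  obtain f where f: "\<And>w. w \<in> V - {0} \<Longrightarrow> euclidean_isometry (f w)"
    "\<And>w x. w \<in> V - {0} \<Longrightarrow> x extreme_point_of zono_face a w \<Longrightarrow> f w x = p x"
    using faces unfolding V_def by (metis DiffE singletonI)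
  have "\<exists>L. orthogonal_transformation L \<and> (\<forall>x. f w x = L x + f w 0)" if "w \<in> V - {0}" for w
    using euclidean_isometryE[OF f(1)[OF that]] by metis
  then obtain L where L: "\<And>w. w \<in> V - {0} \<Longrightarrow> orthogonal_transformation (L w)"
    "\<And>w x. w \<in> V - {0} \<Longrightarrow> f w x = L w x + f w 0"
    by metis
  have L_diff: "L w (x - y) = f w x - f w y" if "w \<in> V - {0}" for w x y
  proof -
    have "L w (x - y) = L w x - L w y"
      using orthogonal_transformation_linear[OF L(1)[OF that]] by (simp add: linear_diff)
    then show ?thesis using L(2)[OF that, of x] L(2)[OF that, of y] by simp
  qed

  have agree: "f w' x = f w x"
    if "w \<in> V - {0}" "w' \<in> V - {0}" "zono_face a w' \<subseteq> zono_face a w" "x \<in> zono_face a w'" for w w' x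
  proof (rule isometries_eq_on_convex_hull[OF f(1)[OF that(2)] f(1)[OF that(1)]])
    fix y assume "y \<in> {y. y extreme_point_of zono_face a w'}"
    then have y: "y extreme_point_of zono_face a w'" by simp
    then have "y \<in> zono_face a w" using that(3) by (auto simp: extreme_point_of_def)
    with y have "y extreme_point_of zono_face a w"
      by (rule extreme_point_of_zono_faceI[OF extreme_point_of_zono_faceD])
    then show "f w' y = f w y" using y f(2) that(1,2) by simp
  next
    show "x \<in> convex hull {y. y extreme_point_of zono_face a w'}"
      using zono_face_convex_hull_extreme_points[of a w'] that(4) by simp
  qed
  have locally_subset: "eventually (\<lambda>w'. w' \<in> S \<and> zono_face a w' \<subseteq> zono_face a w) (at w within S)" for w S
    using eventually_zono_face_subset[of a w]
    by (auto simp: eventually_at_filter elim: eventually_mono)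

  (* The directions of the faces parallel to a i form a connected set ?S. *)
  have "L w (a i) = L w' (a i)" if "w \<in> V - {0}" "w \<bullet> a i = 0" "w' \<in> V - {0}" "w' \<bullet> a i = 0" for w w' i
  proof -
    let ?S = "{w \<in> V. \<forall>x\<in>{a i}. w \<bullet> x = 0} - {0}"
    have "dim V \<le> dim {w \<in> V. \<forall>x\<in>{a i}. w \<bullet> x = 0} + card {a i}"
      by (rule dim_orthogonal_complement_in_subspace_ge) (use V in auto)
    then have "connected ?S"
      using V by (intro connected_punctured_subspace subspace_orthogonal_in_subspace) auto
    moreover have "eventually (\<lambda>w'. L w (a i) = L w' (a i)) (at w within ?S)" if w: "w \<in> ?S" for w
      using locally_subset
    proof (rule eventually_mono)
      fix w' assume w': "w' \<in> ?S \<and> zono_face a w' \<subseteq> zono_face a w"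
      obtain x where x: "x \<in> zono_face a w'" "x + a i \<in> zono_face a w'"
        using zono_face_contains_orthogonal_generator[of w' a i] w' by auto
      then have "f w' x = f w x" "f w' (x + a i) = f w (x + a i)"
        using agree[of w w'] w w' x by blast+
      then show "L w (a i) = L w' (a i)"
        using L_diff[of w "x + a i" x] L_diff[of w' "x + a i" x] w w' by simp
    qed
    ultimately show ?thesis
      using that by (intro connected_local_const[of ?S w w' "\<lambda>w. L w (a i)"]) auto
  qed
  then have "\<exists>c. \<forall>w. w \<in> V - {0} \<longrightarrow> w \<bullet> a i = 0 \<longrightarrow> L w (a i) = c" for i
    by metis
  then obtain b where b: "\<And>i w. w \<in> V - {0} \<Longrightarrow> w \<bullet> a i = 0 \<Longrightarrow> L w (a i) = b i"
    by metis

  (* Some proper face is parallel to both generators because dim V is at least 3. *)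
  have "b i \<bullet> b j = a i \<bullet> a j" for i j
  proof -
    have "dim V \<le> dim {w \<in> V. \<forall>x\<in>{a i, a j}. w \<bullet> x = 0} + card {a i, a j}"
      by (rule dim_orthogonal_complement_in_subspace_ge) (use V in auto)
    moreover have "card {a i, a j} \<le> 2"
      by (simp add: card_insert_if)
    ultimately have "dim {w \<in> V. \<forall>x\<in>{a i, a j}. w \<bullet> x = 0} \<noteq> 0"
      using V(2) by linarith
    then obtain w where "w \<in> V - {0}" "w \<bullet> a i = 0" "w \<bullet> a j = 0"
      unfolding dim_eq_0 by auto
    then show ?thesis
      using b[of w] L(1)[of w] by (metis orthogonal_transformation_def)
  qed
  then obtain T where T: "orthogonal_transformation T" "\<And>i. T (a i) = b i"
    using orthogonal_transformation_of_inner_eq[of UNIV b a] by auto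
  have linT: "linear T" using T(1) by (rule orthogonal_transformation_linear)

  have f_diff: "f w x - f w y = T x - T y"
    if w: "w \<in> V - {0}" and xy: "x \<in> zono_face a w" "y \<in> zono_face a w" for w x y
  proof -
    have "L w (x - y) = T (x - y)"
      by (rule linear_eq_on[OF orthogonal_transformation_linear[OF L(1)[OF w]] linT
            zono_face_diff_in_span[OF xy]]) (auto simp: T(2) b[OF w])
    then show ?thesis using L_diff[OF w] linT by (simp add: linear_diff)
  qed
  (* The linear part is T on every face; only the translations c w remain to be compared. *)
  define pt where "pt w = (SOME x. x \<in> zono_face a w)" for w
  have pt: "pt w \<in> zono_face a w" for w
    by (simp add: pt_def some_in_eq zono_face_nonempty)
  define c where "c w = f w (pt w) - T (pt w)" for w
  have c_eq: "f w x = T x + c w" if "w \<in> V - {0}" "x \<in> zono_face a w" for w x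
    using f_diff[OF that pt] by (simp add: c_def algebra_simps)
  have c_const: "c w = c w'" if "w \<in> V - {0}" "w' \<in> V - {0}" for w w'
  proof (rule connected_local_const[of "V - {0}" w w' c])
    show "connected (V - {0})" using V by (intro connected_punctured_subspace) auto
    show "\<forall>w\<in>V - {0}. eventually (\<lambda>w'. c w = c w') (at w within V - {0})"
    proof
      fix w assume w: "w \<in> V - {0}"
      show "eventually (\<lambda>w'. c w = c w') (at w within V - {0})"
        using locally_subset
      proof (rule eventually_mono)
        fix w' assume w': "w' \<in> V - {0} \<and> zono_face a w' \<subseteq> zono_face a w"
        then have "T (pt w') + c w' = T (pt w') + c w"
          using c_eq[OF w, of "pt w'"] c_eq[of w' "pt w'"] agree[OF w, of w' "pt w'"] pt[of w']
          by (metis subsetD)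
        then show "c w = c w'" by simp
      qed
    qed
  qed (use that in auto)
  have "\<exists>i. a i \<noteq> 0"
    using dim3 by (intro exists_nonzero_if_dim_range_pos) simp
  note vertex_face = extreme_point_in_proper_zono_face[OF _ this, folded V_def]
  have "\<exists>d. \<forall>w\<in>V - {0}. c w = d" using c_const by metis
  then obtain d where d: "\<And>w. w \<in> V - {0} \<Longrightarrow> c w = d" by blast
  show thesis
  proof
    show "euclidean_isometry (\<lambda>x. T x + d)"
      using T(1) by (rule euclidean_isometry_orthogonal_translation)
    fix x assume x: "x extreme_point_of zono_face a 0"
    obtain w where w: "w \<in> V - {0}" "x \<in> zono_face a w"
      using vertex_face[OF x] by auto
    have "x extreme_point_of zono_face a w"
      using x w(2) by (rule extreme_point_of_zono_faceI)
    then show "T x + d = p x"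
      using c_eq[OF w] d[OF w(1)] f(2)[OF w(1)] by simp
  qed
qed

section \<open>Rigidity\<close>

text \<open>
The vertices are recognised by the lattice: the preimage of the face \<open>{y}\<close> is a nonempty face, and the
image of any of its vertices is a nonempty subset of \<open>{y}\<close>.
\<close>

lemma face_lattice_iso_extreme_point_preimage:
  assumes iso: "face_lattice_iso \<phi> P Q" and P: "compact P" "convex P"
    and y: "y extreme_point_of Q"
  obtains x where "x extreme_point_of P" "\<phi> {x} = {y}"
proof -
  have image_faces: "\<phi> ` {F. F face_of P} = {G. G face_of Q}"
    using iso unfolding face_lattice_iso_def by (blast dest: bij_betw_imp_surj_on)
  have surj: "\<exists>F. F face_of P \<and> \<phi> F = G" if "G face_of Q" for G
  proof -
    have "G \<in> \<phi> ` {F. F face_of P}" unfolding image_faces using that by simp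
    then obtain F where "G = \<phi> F" "F \<in> {F. F face_of P}" by (rule imageE)
    then show ?thesis by (intro exI[of _ F]) simp
  qed
  have mono: "F \<subseteq> G \<longleftrightarrow> \<phi> F \<subseteq> \<phi> G" if "F face_of P" "G face_of P" for F G
    using iso[unfolded face_lattice_iso_def, THEN conjunct2, rule_format, OF that] .
  obtain F where F: "F face_of P" "\<phi> F = {y}"
    using surj[of "{y}"] y by (auto simp: face_of_singleton)
  obtain E where "E face_of P" "\<phi> E = {}"
    using surj[of "{}"] empty_face_of by blast
  then have \<phi>_empty: "F' = {}" if "F' face_of P" "\<phi> F' = {}" for F'
    using mono[of F' E] mono[of E "{}"] that empty_face_of[of P] by simp
  have "F \<noteq> {}"
  proof
    assume "F = {}"
    then have "\<phi> F \<subseteq> \<phi> E" using mono[of F E] F \<open>E face_of P\<close> by simp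
    then show False using F \<open>\<phi> E = {}\<close> by simp
  qed
  moreover have "compact F" "convex F"
    using F P by (auto intro: face_of_imp_compact face_of_imp_convex)
  ultimately obtain x where x: "x extreme_point_of F"
    using extreme_point_exists_convex by blast
  then have xP: "x extreme_point_of P" "{x} face_of P" "x \<in> F"
    using extreme_point_of_face[OF F(1)] face_of_singleton by auto
  moreover have "\<phi> {x} \<subseteq> {y}"
    using mono[OF xP(2) F(1)] xP(3) F(2) by simp
  moreover have "\<phi> {x} \<noteq> {}"
    using \<phi>_empty[OF xP(2)] by auto
  ultimately show thesis using that by blast
qed

theorem proposition3p8:
  fixes A :: "real^'k^'n" and B :: "real^'m^'n"
    and \<phi> :: "(real^'n) set \<Rightarrow> (real^'n) set"
  assumes "CARD('n) \<ge> 3"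
    and "aff_dim (zonotope A) \<ge> 3"
    and "face_lattice_iso \<phi> (zonotope A) (zonotope B)"
    and "congruent_corresponding_facets \<phi> (zonotope A)"
  shows "congruent_sets (zonotope A) (zonotope B)"
proof -
  define a where "a i = column i A" for i
  define P where "P = zonotope A"
  define Q where "Q = zonotope B"
  have P_eq: "P = zono_face a 0"
    by (simp add: P_def zonotope_eq_zono_face a_def[abs_def])
  have polytopes: "polytope P" "polytope Q"
    by (simp_all add: P_def Q_def zonotope_eq_zono_face polytope_zono_face_0)
  have iso: "face_lattice_iso \<phi> P Q" using assms(3) by (simp add: P_def Q_def)

  have "0 \<in> P" by (auto simp: P_def zonotope_def intro!: exI[of _ "\<lambda>_. 0"])
  then have "aff_dim P = int (dim P)"
    by (intro aff_dim_zero hull_inc)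
  moreover have "dim P \<le> dim (range a)"
    using zono_face_subset_span[of a 0] unfolding P_eq by (metis dim_span dim_subset)
  ultimately have dim3: "3 \<le> dim (range a)"
    using assms(2) by (simp add: P_def)

  have face_isometry: "\<exists>f. euclidean_isometry f \<and> (\<forall>x. x extreme_point_of zono_face a w \<longrightarrow> \<phi> {x} = {f x})"
    if w: "w \<in> span (range a)" "w \<noteq> 0" for w
  proof -
    have Fw: "zono_face a w face_of P" unfolding P_eq by (rule zono_face_face_of)
    obtain F where F: "F facet_of P" "zono_face a w \<subseteq> F"
      using face_of_polyhedron_subset_facet[OF polytope_imp_polyhedron[OF polytopes(1)] Fw zono_face_nonempty]
        zono_face_proper[OF w] P_eq by metis
    obtain f where f: "euclidean_isometry f" "\<And>G. G face_of F \<Longrightarrow> f ` G = \<phi> G"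
      using assms(4) F(1) unfolding congruent_corresponding_facets_def P_def by blast
    have "F \<subseteq> P" using F(1) by (rule facet_of_imp_subset)
    then have "zono_face a w face_of F"
      using face_of_subset[OF Fw F(2)] by blast
    then have "{x} face_of F" if "x extreme_point_of zono_face a w" for x
      using that face_of_singleton face_of_trans by metis
    then show ?thesis using f by fastforce
  qed

  have "\<exists>i. a i \<noteq> 0"
    using dim3 by (intro exists_nonzero_if_dim_range_pos) simp
  then have vertex_image: "\<exists>y. \<phi> {x} = {y}" if "x extreme_point_of P" for x
    using that extreme_point_in_proper_zono_face[of x a] face_isometry
      extreme_point_of_zono_faceI[of x a] unfolding P_eq by metis
  then obtain p where p: "\<And>x. x extreme_point_of P \<Longrightarrow> \<phi> {x} = {p x}"
    by metis
  have "\<exists>f. euclidean_isometry f \<and> (\<forall>x. x extreme_point_of zono_face a w \<longrightarrow> f x = p x)"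
    if w: "w \<in> span (range a)" "w \<noteq> 0" for w
  proof -
    obtain f where f: "euclidean_isometry f" "\<And>x. x extreme_point_of zono_face a w \<Longrightarrow> \<phi> {x} = {f x}"
      using face_isometry[OF w] by blast
    have "f x = p x" if "x extreme_point_of zono_face a w" for x
      using f(2)[OF that] p[of x] extreme_point_of_zono_faceD[OF that] by (simp add: P_eq)
    then show ?thesis using f(1) by blast
  qed
  from face_isometries_glue[OF dim3 this]
  obtain g where g: "euclidean_isometry g" "\<And>x. x extreme_point_of P \<Longrightarrow> g x = p x"
    unfolding P_eq by blast

  have "g ` {x. x extreme_point_of P} = {y. y extreme_point_of Q}"
  proof (intro equalityI subsetI)
    fix y assume "y \<in> g ` {x. x extreme_point_of P}"
    then obtain x where x: "x extreme_point_of P" "y = g x" by blast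
    then have "{x} face_of P" by (simp add: face_of_singleton)
    then have "\<phi> {x} face_of Q" using iso by (auto simp: face_lattice_iso_def bij_betw_def)
    then show "y \<in> {y. y extreme_point_of Q}"
      using x(2) p[OF x(1)] g(2)[OF x(1)] by (simp add: face_of_singleton)
  next
    fix y assume "y \<in> {y. y extreme_point_of Q}"
    then obtain x where "x extreme_point_of P" "\<phi> {x} = {y}"
      using face_lattice_iso_extreme_point_preimage[OF iso] polytopes(1)
        polytope_imp_compact polytope_imp_convex by blast
    then show "y \<in> g ` {x. x extreme_point_of P}"
      using p g(2) by auto
  qed
  moreover obtain L where L: "orthogonal_transformation L" "\<And>x. g x = L x + g 0"
    using euclidean_isometryE[OF g(1)] by blast
  have "g ` (convex hull X) = convex hull (g ` X)" for X
  proof -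
    have img: "g ` Y = (+) (g 0) ` (L ` Y)" for Y
      unfolding image_image by (rule image_cong) (use L(2) add.commute in metis)+
    have "g ` (convex hull X) = (+) (g 0) ` (convex hull (L ` X))"
      by (simp only: img convex_hull_linear_image[OF orthogonal_transformation_linear[OF L(1)]])
    also have "\<dots> = convex hull (g ` X)"
      by (simp only: img[of X] convex_hull_translation)
    finally show ?thesis .
  qed
  ultimately have "g ` P = Q"
    using Krein_Milman_Minkowski polytopes polytope_imp_compact polytope_imp_convex by metis
  then show ?thesis
    using g(1) unfolding congruent_sets_def P_def Q_def by blast
qed

end
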